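(* Let $C\ge1$ and let $\mathcal{D}$ be a probability distribution on $[0,\infty)$ with finite support. There is a threshold $\alpha\in[0,1]$, depending on $\mathcal{D}$ (and $C$), such that for every $n\ge1$ and i.i.d. input sequence $X_1,\dots,X_n$ with common distribution $\mathcal{D}$, the threshold policy $\mathcal{P}_\alpha$, which stops using a bin once its usage exceeds $\alpha$, satisfies \[ \mathrm{cost}(\mathcal{P}_\alpha)\le(3+2\sqrt2)\,\mathrm{cost}(\mathrm{OPT})+1, \] where $\mathrm{OPT}$ denotes the optimal policy that knows $n$ in advance.
   Context: Model. $C\ge 1$ is a penalty parameter. The items are independent nonnegative random variables $X_1,\dots,X_n$, and there are unit-capacity bins $B_1,\dots,B_n$. Items are packed sequentially in the order $1,\dots,n$: at round $i$ a (deterministic) policy, which may know $n$ and all distributions in advance, chooses the bin for item $i$ as a function of the history (the bins chosen for and the realized sizes of items $1,\dots,i-1$); then the size of $X_i$ is revealed. The usage of a bin is the sum of the realized sizes of the items packed into it so far. A bin is overflowed once its usage exceeds $1$; a policy never packs an item into an already overflowed bin. A bin is opened when it receives its first item. $N_{\mathcal{P}}$ is the number of bins opened, $O_{\mathcal{P}}$ the number of bins overflowed, $\mathrm{cost}(\mathcal{P})=\mathbf{E}[N_{\mathcal{P}}]+C\,\mathbf{E}[O_{\mathcal{P}}]$, and $\mathrm{cost}(\mathrm{OPT})=\inf_{\mathcal{P}}\mathrm{cost}(\mathcal{P})$ over all policies. For $\alpha\in[0,1]$, the threshold policy $\mathcal{P}_\alpha$ opens a bin for the first item, packs each arriving item into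 the current bin as long as the current bin's usage is at most $\alpha$, and otherwise opens a new bin for the item, which becomes the current bin (so only one bin is active at a time). *)

theory Defs
  imports "HOL-Probability.Probability"
begin

text \<open>
  Items and bins are numbered \<open>1, \<dots>, n\<close>. A history lists, in chronological order, the bin chosen
  for and the realized size of every item packed so far. A policy that knows \<open>n\<close> and the
  distributions is an arbitrary function of the history, chosen after \<open>n\<close> and the distributions
  have been fixed.
\<close>

type_synonym history = "(nat \<times> real) list"
type_synonym policy = "history \<Rightarrow> nat"

primrec run :: "policy \<Rightarrow> (nat \<Rightarrow> real) \<Rightarrow> nat \<Rightarrow> history" where
  "run P x 0 = []"
| "run P x (Suc i) = run P x i @ [(P (run P x i), x (Suc i))]"

definition usage :: "history \<Rightarrow> nat \<Rightarrow> real" where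
  "usage h b = (\<Sum>(c, s)\<leftarrow>h. if c = b then s else 0)"

definition opened :: "history \<Rightarrow> nat set" where
  "opened h = fst ` set h"

definition overflowed :: "history \<Rightarrow> nat set" where
  "overflowed h = {b \<in> opened h. usage h b > 1}"

text \<open>
  Only histories that the policy itself can produce on nonnegative sizes are constrained.
\<close>

definition is_policy :: "nat \<Rightarrow> policy \<Rightarrow> bool" where
  "is_policy n P \<longleftrightarrow> (\<forall>x. (\<forall>i\<in>{1..n}. 0 \<le> x i) \<longrightarrow>
     (\<forall>i<n. P (run P x i) \<in> {1..n} \<and> P (run P x i) \<notin> overflowed (run P x i)))"

text \<open>
  The joint law of independent items with \<open>X\<^sub>i \<sim> D i\<close> is the product distribution. The
  distributions are discrete, so no measurability condition on policies is needed, and both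
  random variables below are bounded by \<open>n\<close>, hence integrable.
\<close>

definition cost :: "real \<Rightarrow> nat \<Rightarrow> (nat \<Rightarrow> real pmf) \<Rightarrow> policy \<Rightarrow> real" where
  "cost C n D P =
     measure_pmf.expectation (Pi_pmf {1..n} 0 D) (\<lambda>x. real (card (opened (run P x n)))) +
     C * measure_pmf.expectation (Pi_pmf {1..n} 0 D) (\<lambda>x. real (card (overflowed (run P x n))))"

definition opt :: "real \<Rightarrow> nat \<Rightarrow> (nat \<Rightarrow> real pmf) \<Rightarrow> real" where
  "opt C n D = (INF P\<in>{P. is_policy n P}. cost C n D P)"

text \<open>
  Bins are opened in the order \<open>1, 2, \<dots>\<close>, so the current bin \<open>b\<close> is the one of the last item and
  \<open>Suc b\<close> is unopened.
\<close>

definition threshold :: "real \<Rightarrow> policy" where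
  "threshold \<alpha> h =
     (if h = [] then 1
      else let b = fst (last h) in if usage h b \<le> \<alpha> then b else Suc b)"

text \<open>
  The infimum in \<^const>\<open>opt\<close> is a genuine one: it ranges over a nonempty family of policies,
  which contains the threshold policies, and the costs are bounded below.
\<close>

lemma threshold_run_bins:
  "fst ` set (run (threshold \<alpha>) x i) \<subseteq> {1..i} \<and>
   (run (threshold \<alpha>) x i \<noteq> [] \<longrightarrow>
     (\<forall>c \<in> fst ` set (run (threshold \<alpha>) x i). c \<le> fst (last (run (threshold \<alpha>) x i))))"
proof (induction i)
  case (Suc i)
  let ?h = "run (threshold \<alpha>) x i"
  let ?b = "threshold \<alpha> ?h"
  have b: "?b \<in> {1..Suc i} \<and> (\<forall>c \<in> fst ` set ?h. c \<le> ?b)"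
  proof (cases "?h = []")
    case True
    then show ?thesis by (simp add: threshold_def[of \<alpha> "[]"])
  next
    case False
    then have "fst (last ?h) \<in> fst ` set ?h" by simp
    with Suc.IH have "fst (last ?h) \<in> {1..i}" by blast
    moreover have "?b = fst (last ?h) \<or> ?b = Suc (fst (last ?h))"
      using False by (simp add: threshold_def[of \<alpha> ?h] Let_def)
    ultimately show ?thesis using Suc.IH False
      by (metis Suc_le_mono atLeastAtMost_iff le_SucI)
  qed
  have "{1..i} \<subseteq> {1..Suc i}" by auto
  with b Suc.IH show ?case by auto
qed simp

lemma is_policy_threshold:
  assumes "\<alpha> \<le> 1"
  shows "is_policy n (threshold \<alpha>)"
  unfolding is_policy_def
proof (intro allI impI)
  fix x :: "nat \<Rightarrow> real" and i
  assume "i < n"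
  let ?h = "run (threshold \<alpha>) x i"
  have "threshold \<alpha> ?h \<in> fst ` set (run (threshold \<alpha>) x (Suc i))" by simp
  then have "threshold \<alpha> ?h \<in> {1..Suc i}"
    using threshold_run_bins[of \<alpha> x "Suc i"] by blast
  moreover have "threshold \<alpha> ?h \<notin> overflowed ?h"
  proof (cases "?h = []")
    case True
    then show ?thesis by (simp add: overflowed_def opened_def)
  next
    case False
    then have "\<forall>c \<in> opened ?h. c \<le> fst (last ?h)"
      using threshold_run_bins[of \<alpha> x i] unfolding opened_def by blast
    then show ?thesis
      using assms False by (auto simp: threshold_def[of \<alpha> ?h] Let_def overflowed_def)
  qed
  ultimately show "threshold \<alpha> ?h \<in> {1..n} \<and> threshold \<alpha> ?h \<notin> overflowed ?h"
    using \<open>i < n\<close> by auto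
qed

lemma bdd_below_cost:
  assumes "0 \<le> C"
  shows "bdd_below (cost C n D ` {P. is_policy n P})"
  using assms by (intro bdd_belowI2[where m = 0]) (simp add: cost_def integral_nonneg_AE)

end

theory Submission
  imports Defs
begin

text \<open>
  The threshold policy is optimal up to an additive \<open>1\<close>, by an optimal stopping argument for a
  single bin and a potential that adds up over the bins.

  Consider one bin, let every item packed into it earn a reward \<open>l\<close>, and charge \<open>C\<close> for an
  overflow. The next item is worth packing at usage \<open>u\<close> if its expected gain
  \<open>l - C * P(u + X > 1)\<close> is nonnegative. This gain decreases in \<open>u\<close> and the usage never decreases, so
  a myopic rule is optimal: go on exactly while the usage is at most a threshold \<open>\<alpha>\<close>. Let \<open>\<Phi> u\<close> be
  the expected amount still to be gained from usage \<open>u\<close>. If the items are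
  not all \<open>0\<close>, a bin takes finitely many of them in expectation, and \<open>\<Phi> 0\<close> is finite and continuous
  in \<open>l\<close>. So the reward can be chosen such that \<open>\<Phi> 0 = 1\<close>: a new bin is worth exactly the price of
  opening it (\<open>bin_value_exists\<close>).

  Now give a bin of usage \<open>u\<close> the potential \<open>1 - \<Phi> u\<close>, plus \<open>C\<close> if it has overflowed. An unused
  bin has potential \<open>0\<close>, so opening a bin needs no separate accounting. By the Bellman inequality
  for \<open>\<Phi>\<close>, each item raises the total potential by at least \<open>l\<close> in expectation, whatever the
  policy does; under the threshold policy, which packs only at usage at most \<open>\<alpha>\<close>, by exactly \<open>l\<close>. The
  cost of a packing exceeds its potential by the sum of \<open>\<Phi>\<close> over the opened bins. This sum is
  nonnegative, so every policy costs at least \<open>l * n\<close> (\<open>policy_cost_ge\<close>). For the threshold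
  policy all bins but the current one have usage above \<open>\<alpha>\<close>, where \<open>\<Phi>\<close> vanishes, so the sum is at
  most \<open>1\<close> and the cost is at most \<open>l * n + 1\<close> (\<open>threshold_cost_le\<close>).
\<close>

section \<open>Running a policy on i.i.d. items\<close>

lemma run_cong:
  assumes "\<And>j. j \<in> {1..i} \<Longrightarrow> x j = y j"
  shows "run P x i = run P y i"
  using assms by (induction i) auto

lemma finite_set_Pi_pmf:
  assumes "finite A" "\<And>i. i \<in> A \<Longrightarrow> finite (set_pmf (p i))"
  shows "finite (set_pmf (Pi_pmf A d p))"
  using assms by (simp add: set_Pi_pmf finite_PiE_dflt)

lemma integrable_iid:
  fixes f :: "(nat \<Rightarrow> real) \<Rightarrow> real"
  assumes "finite (set_pmf D)"
  shows "integrable (measure_pmf (Pi_pmf {1..n} 0 (\<lambda>_. D))) f"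
  using assms by (intro integrable_measure_pmf_finite finite_set_Pi_pmf) auto

lemma nonneg_iid:
  fixes D :: "real pmf" and n :: nat
  assumes "set_pmf D \<subseteq> {0..}" "x \<in> set_pmf (Pi_pmf {1..n} 0 (\<lambda>_. D))"
  shows "0 \<le> x j"
  using assms by (cases "j \<in> {1..n}") (auto simp: set_Pi_pmf PiE_dflt_def)

text \<open>
  The history before a round is independent of the item of that round, so the last item can be
  integrated out first.
\<close>

lemma expectation_run_Suc:
  fixes f :: "history \<Rightarrow> real"
  assumes "finite (set_pmf D)"
  shows "measure_pmf.expectation (Pi_pmf {1..Suc i} 0 (\<lambda>_. D)) (\<lambda>x. f (run P x (Suc i))) =
    measure_pmf.expectation (Pi_pmf {1..i} 0 (\<lambda>_. D))
      (\<lambda>x. measure_pmf.expectation D (\<lambda>s. f (run P x i @ [(P (run P x i), s)])))"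
proof -
  let ?M = "Pi_pmf {1..i} 0 (\<lambda>_. D)"
  have fin: "finite (set_pmf ?M)"
    using assms by (intro finite_set_Pi_pmf) auto
  have "{1..Suc i} = insert (Suc i) {1..i}" by auto
  then have "Pi_pmf {1..Suc i} 0 (\<lambda>_. D) = do {y \<leftarrow> D; x \<leftarrow> ?M; return_pmf (x(Suc i := y))}"
    by (simp only:) (subst Pi_pmf_insert', auto)
  also have "\<dots> = do {x \<leftarrow> ?M; y \<leftarrow> D; return_pmf (x(Suc i := y))}"
    by (rule bind_commute_pmf)
  also have "\<dots> = ?M \<bind> (\<lambda>x. map_pmf (\<lambda>y. x(Suc i := y)) D)"
    by (simp add: map_pmf_def)
  finally have M: "Pi_pmf {1..Suc i} 0 (\<lambda>_. D) = ?M \<bind> (\<lambda>x. map_pmf (\<lambda>y. x(Suc i := y)) D)" .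
  have upd: "run P (x(Suc i := y)) i = run P x i" for x y
    by (rule run_cong) auto
  show ?thesis
    unfolding M using fin assms
    by (subst pmf_expectation_bind[OF fin])
      (auto simp: upd integral_measure_pmf[OF fin])
qed

text \<open>
  Drift bounds add up over the rounds. Applied to \<open>- \<Psi>\<close> and \<open>- l\<close> this also yields upper bounds.
\<close>

lemma expectation_run_drift:
  fixes \<Psi> :: "history \<Rightarrow> real"
  assumes fin: "finite (set_pmf D)" and nonneg: "set_pmf D \<subseteq> {0..}"
    and drift: "\<And>x i. (\<And>j. 0 \<le> x j) \<Longrightarrow> i < n \<Longrightarrow>
      \<Psi> (run P x i) + l \<le> measure_pmf.expectation D (\<lambda>s. \<Psi> (run P x i @ [(P (run P x i), s)]))"
    and "i \<le> n"
  shows "\<Psi> [] + l * real i \<le>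
    measure_pmf.expectation (Pi_pmf {1..i} 0 (\<lambda>_. D)) (\<lambda>x. \<Psi> (run P x i))"
  using \<open>i \<le> n\<close>
proof (induction i)
  case (Suc i)
  let ?M = "Pi_pmf {1..i} 0 (\<lambda>_. D)"
  note int = integrable_iid[OF fin]
  have "measure_pmf.expectation ?M (\<lambda>x. \<Psi> (run P x i) + l) \<le>
      measure_pmf.expectation ?M
        (\<lambda>x. measure_pmf.expectation D (\<lambda>s. \<Psi> (run P x i @ [(P (run P x i), s)])))"
    using Suc.prems by (intro integral_mono_AE int)
      (auto simp: AE_measure_pmf_iff simp del: One_nat_def intro!: drift intro: nonneg_iid[OF nonneg])
  also have "measure_pmf.expectation ?M (\<lambda>x. \<Psi> (run P x i) + l) =
      measure_pmf.expectation ?M (\<lambda>x. \<Psi> (run P x i)) + l"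
    by (subst Bochner_Integration.integral_add[OF int]) auto
  finally show ?case
    using Suc by (simp only: expectation_run_Suc[OF fin] of_nat_Suc) (simp add: algebra_simps)
qed simp

section \<open>Bins and their usage\<close>

lemma usage_Nil [simp]: "usage [] b = 0"
  by (simp add: usage_def)

lemma usage_snoc: "usage (h @ [(c, s)]) b = usage h b + (if c = b then s else 0)"
  by (simp add: usage_def)

lemma usage_unopened: "b \<notin> opened h \<Longrightarrow> usage h b = 0"
  by (induction h rule: rev_induct) (auto simp: usage_snoc opened_def)

lemma usage_run_nonneg: "(\<And>j. 0 \<le> x j) \<Longrightarrow> 0 \<le> usage (run P x i) b"
  by (induction i) (auto simp: usage_snoc)

lemma sum_usage_snoc:
  fixes g :: "real \<Rightarrow> real"
  assumes "finite B" "c \<in> B"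
  shows "(\<Sum>b\<in>B. g (usage (h @ [(c, s)]) b)) =
    (\<Sum>b\<in>B. g (usage h b)) + (g (usage h c + s) - g (usage h c))"
  using assms by (subst (1 2) sum.remove[of B c]) (auto simp: usage_snoc intro!: sum.cong)

lemma opened_run_subset:
  assumes "is_policy n P" "\<And>j. 0 \<le> x j" "i \<le> n"
  shows "opened (run P x i) \<subseteq> {1..n}"
  using assms(3)
proof (induction i)
  case (Suc i)
  have "P (run P x i) \<in> {1..n}"
    using assms(1,2) Suc.prems unfolding is_policy_def by auto
  then show ?case using Suc by (auto simp: opened_def)
qed (simp add: opened_def)

lemma threshold_usage_le:
  assumes "0 \<le> \<alpha>"
  shows "usage (run (threshold \<alpha>) x i) (threshold \<alpha> (run (threshold \<alpha>) x i)) \<le> \<alpha>"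
proof -
  let ?h = "run (threshold \<alpha>) x i"
  have "usage ?h (Suc (fst (last ?h))) = 0" if "?h \<noteq> []"
    using that threshold_run_bins[of \<alpha> x i]
    by (intro usage_unopened) (force simp: opened_def)
  then show ?thesis
    using assms by (auto simp: threshold_def[of \<alpha> ?h] Let_def)
qed

text \<open>
  A bin is left only when its usage exceeds \<open>\<alpha>\<close>, and is never used again.
\<close>

lemma threshold_closed_usage:
  assumes "b \<in> opened (run (threshold \<alpha>) x i)" "b \<noteq> fst (last (run (threshold \<alpha>) x i))"
  shows "usage (run (threshold \<alpha>) x i) b > \<alpha>"
  using assms
proof (induction i)
  case (Suc i)
  let ?h = "run (threshold \<alpha>) x i"
  have b: "b \<in> opened ?h" "b \<noteq> threshold \<alpha> ?h"
    using Suc.prems by (auto simp: opened_def)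
  then have "?h \<noteq> []" by (auto simp: opened_def)
  have "usage ?h b > \<alpha>"
  proof (cases "b = fst (last ?h)")
    case True
    then show ?thesis
      using b(2) \<open>?h \<noteq> []\<close> by (auto simp: threshold_def[of \<alpha> ?h] Let_def split: if_splits)
  next
    case False
    then show ?thesis using Suc.IH b(1) by simp
  qed
  then show ?case using b(2) by (simp add: usage_snoc)
qed (simp add: opened_def)

section \<open>The value of a bin\<close>

locale finite_item_law =
  fixes C :: real and D :: "real pmf"
  assumes C_nonneg: "0 \<le> C"
    and finite_support: "finite (set_pmf D)"
    and support_nonneg: "set_pmf D \<subseteq> {0..}"
begin

abbreviation E :: "(real \<Rightarrow> real) \<Rightarrow> real" where
  "E \<equiv> measure_pmf.expectation D"

definition overflow_prob :: "real \<Rightarrow> real" where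
  "overflow_prob u = E (\<lambda>x. of_bool (u + x > 1))"

lemma integrable_item [simp]:
  fixes f :: "real \<Rightarrow> real"
  shows "integrable (measure_pmf D) f"
  by (rule integrable_measure_pmf_finite[OF finite_support])

lemma E_mono: "(\<And>x. x \<in> set_pmf D \<Longrightarrow> f x \<le> g x) \<Longrightarrow> E f \<le> E g"
  by (rule integral_mono_AE) (auto simp: AE_measure_pmf_iff)

lemma E_nonneg: "(\<And>x. 0 \<le> f x) \<Longrightarrow> 0 \<le> E f"
  by (rule integral_nonneg_AE) simp

lemma overflow_prob_nonneg: "0 \<le> overflow_prob u"
  unfolding overflow_prob_def by (rule E_nonneg) simp

lemma overflow_prob_mono: "u \<le> v \<Longrightarrow> overflow_prob u \<le> overflow_prob v"
  unfolding overflow_prob_def by (rule E_mono) auto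

text \<open>
  These are the optimality conditions of the one-bin stopping problem in which every packed item
  earns \<open>l\<close> and an overflow costs \<open>C\<close>: the Bellman inequality wherever packing is permitted, with
  equality up to \<open>\<alpha>\<close>, where it is optimal to go on, and \<open>\<Phi> = 0\<close> above \<open>\<alpha>\<close>, where it is optimal to
  stop. The normalization \<open>\<Phi> 0 = 1\<close> makes a new bin break even against the unit price of opening it
  and thereby determines \<open>l\<close> as the infimum of the cost per item that a single bin can
  achieve.
\<close>

definition bin_value :: "real \<Rightarrow> real \<Rightarrow> (real \<Rightarrow> real) \<Rightarrow> bool" where
  "bin_value l \<alpha> \<Phi> \<longleftrightarrow> 0 \<le> l \<and> \<alpha> \<in> {0..1} \<and> \<Phi> 0 = 1 \<and>
    (\<forall>u\<ge>0. 0 \<le> \<Phi> u \<and> \<Phi> u \<le> 1) \<and> (\<forall>u>\<alpha>. \<Phi> u = 0) \<and>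
    (\<forall>u\<in>{0..1}. l - C * overflow_prob u + E (\<lambda>x. \<Phi> (u + x)) \<le> \<Phi> u) \<and>
    (\<forall>u\<in>{0..\<alpha>}. \<Phi> u = l - C * overflow_prob u + E (\<lambda>x. \<Phi> (u + x)))"

text \<open>
  Value iteration with horizon \<open>k\<close>. Instead of a maximum over stopping and going on it takes the
  positive part of the one-step gain: usage only grows, so a one-step gain that is negative once
  stays negative, and adding the positive parts along the random walk of the usage amounts to
  stopping at the right moment.
\<close>

primrec value_iter :: "real \<Rightarrow> nat \<Rightarrow> real \<Rightarrow> real" where
  "value_iter l 0 u = 0"
| "value_iter l (Suc k) u =
    (if u > 1 then 0 else max 0 (l - C * overflow_prob u) + E (\<lambda>x. value_iter l k (u + x)))"

lemma value_iter_nonneg: "0 \<le> value_iter l k u"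
  by (induction k arbitrary: u) (auto intro!: add_nonneg_nonneg E_nonneg)

lemma value_iter_incseq: "value_iter l k u \<le> value_iter l (Suc k) u"
proof (induction k arbitrary: u)
  case 0
  then show ?case using value_iter_nonneg[of l "Suc 0" u] by simp
next
  case (Suc k)
  have "E (\<lambda>x. value_iter l k (u + x)) \<le> E (\<lambda>x. value_iter l (Suc k) (u + x))"
    by (rule E_mono) (rule Suc)
  then show ?case
    by (simp only: value_iter.simps(2)[of l k u] value_iter.simps(2)[of l "Suc k" u]) simp
qed

lemma value_iter_antimono: "u \<le> v \<Longrightarrow> value_iter l k v \<le> value_iter l k u"
proof (induction k arbitrary: u v)
  case (Suc k)
  have "E (\<lambda>x. value_iter l k (v + x)) \<le> E (\<lambda>x. value_iter l k (u + x))"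
    using Suc by (intro E_mono) auto
  moreover have "C * overflow_prob u \<le> C * overflow_prob v"
    using Suc.prems C_nonneg by (intro mult_left_mono overflow_prob_mono)
  moreover have "0 \<le> max 0 (l - C * overflow_prob u) + E (\<lambda>x. value_iter l k (u + x))"
    by (intro add_nonneg_nonneg E_nonneg value_iter_nonneg) auto
  ultimately show ?case using Suc.prems by auto
qed simp

text \<open>
  If the next item is not worth packing, no later one is.
\<close>

lemma value_iter_eq_0:
  assumes "l \<le> C * overflow_prob u"
  shows "value_iter l k u = 0"
  using assms
proof (induction k arbitrary: u)
  case (Suc k)
  have "value_iter l k (u + x) = 0" if "x \<in> set_pmf D" for x
  proof (rule Suc.IH)
    have "overflow_prob u \<le> overflow_prob (u + x)"
      using that support_nonneg by (intro overflow_prob_mono) auto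
    then show "l \<le> C * overflow_prob (u + x)"
      using Suc.prems mult_left_mono[OF _ C_nonneg] by fastforce
  qed
  then have "E (\<lambda>x. value_iter l k (u + x)) = E (\<lambda>x. 0)"
    by (intro integral_cong_AE) (auto simp: AE_measure_pmf_iff)
  then show ?case using Suc.prems by simp
qed simp

text \<open>
  The capped usage \<open>min u 2\<close> grows by at least \<open>min X 1\<close> in each step that starts at \<open>u \<le> 1\<close>, and
  \<open>2 - min u 2\<close> is the distance still to go. So \<open>escape_bound u\<close> dominates the expected number
  of items that a bin of usage \<open>u\<close> can take, which keeps its value finite.
\<close>

definition escape_bound :: "real \<Rightarrow> real" where
  "escape_bound u = (2 - min u 2) / E (\<lambda>x. min x 1)"

context
  assumes pos: "0 < E (\<lambda>x. min x 1)"
begin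

lemma escape_bound_nonneg: "0 \<le> escape_bound u"
  using pos by (simp add: escape_bound_def)

lemma escape_bound_step:
  assumes "u \<le> 1"
  shows "1 + E (\<lambda>x. escape_bound (u + x)) \<le> escape_bound u"
proof -
  let ?m = "E (\<lambda>x. min x 1)"
  have "E (\<lambda>x. escape_bound (u + x)) \<le> E (\<lambda>x. (2 - u - min x 1) / ?m)"
  proof (rule E_mono)
    fix x
    show "escape_bound (u + x) \<le> (2 - u - min x 1) / ?m"
      using pos assms by (auto simp: escape_bound_def intro!: divide_right_mono)
  qed
  also have "\<dots> = (2 - u - ?m) / ?m"
    by simp
  finally show ?thesis
    using pos assms by (simp add: escape_bound_def field_simps)
qed

text \<open>
  Changing the reward by \<open>\<delta>\<close> changes the gain from each packed item by at most \<open>\<delta>\<close>, and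
  \<open>escape_bound\<close> bounds the expected number of these items. For \<open>l' = 0\<close> this also bounds the iterates
  uniformly in the horizon.
\<close>

lemma value_iter_lipschitz:
  "\<bar>value_iter l k u - value_iter l' k u\<bar> \<le> \<bar>l - l'\<bar> * escape_bound u"
proof (induction k arbitrary: u)
  case 0
  then show ?case by (simp add: escape_bound_nonneg)
next
  case (Suc k)
  show ?case
  proof (cases "u \<le> 1")
    case True
    have "\<bar>E (\<lambda>x. value_iter l k (u + x)) - E (\<lambda>x. value_iter l' k (u + x))\<bar>
        = \<bar>E (\<lambda>x. value_iter l k (u + x) - value_iter l' k (u + x))\<bar>"
      by simp
    also have "\<dots> \<le> E (\<lambda>x. \<bar>value_iter l k (u + x) - value_iter l' k (u + x)\<bar>)"
      by (rule integral_abs_bound)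
    also have "\<dots> \<le> E (\<lambda>x. \<bar>l - l'\<bar> * escape_bound (u + x))"
      by (rule E_mono) (rule Suc)
    finally have "\<bar>E (\<lambda>x. value_iter l k (u + x)) - E (\<lambda>x. value_iter l' k (u + x))\<bar>
        \<le> \<bar>l - l'\<bar> * E (\<lambda>x. escape_bound (u + x))"
      by simp
    moreover have "\<bar>l - l'\<bar> * (1 + E (\<lambda>x. escape_bound (u + x))) \<le> \<bar>l - l'\<bar> * escape_bound u"
      by (intro mult_left_mono escape_bound_step True) auto
    ultimately show ?thesis using True by (auto simp: max_def algebra_simps)
  next
    case False
    then show ?thesis by (simp add: escape_bound_nonneg)
  qed
qed

definition bin_gain :: "real \<Rightarrow> real \<Rightarrow> real" where
  "bin_gain l u = lim (\<lambda>k. value_iter l k u)"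

lemma value_iter_tendsto: "(\<lambda>k. value_iter l k u) \<longlonglongrightarrow> bin_gain l u"
proof -
  have "value_iter 0 k u = 0" for k
    by (rule value_iter_eq_0) (simp add: C_nonneg overflow_prob_nonneg)
  then have "value_iter l k u \<le> \<bar>l\<bar> * escape_bound u" for k
    using value_iter_lipschitz[of l k u 0] by simp
  then have "convergent (\<lambda>k. value_iter l k u)"
    using value_iter_nonneg[of l _ u] value_iter_incseq[of l _ u]
    by (intro Bseq_monoseq_convergent BseqI'[where K = "\<bar>l\<bar> * escape_bound u"])
      (simp_all only: real_norm_def abs_of_nonneg monoseq_Suc, simp_all)
  then show ?thesis
    by (simp add: bin_gain_def convergent_LIMSEQ_iff)
qed

lemma bin_gain_nonneg: "0 \<le> bin_gain l u"
  by (rule LIMSEQ_le_const[OF value_iter_tendsto]) (auto simp: value_iter_nonneg)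

lemma bin_gain_antimono: "u \<le> v \<Longrightarrow> bin_gain l v \<le> bin_gain l u"
  by (rule LIMSEQ_le[OF value_iter_tendsto value_iter_tendsto]) (auto intro: value_iter_antimono)

lemma bin_gain_eq_0: "l \<le> C * overflow_prob u \<Longrightarrow> bin_gain l u = 0"
  by (simp add: bin_gain_def value_iter_eq_0)

lemma bin_gain_beyond_1:
  assumes "u > 1"
  shows "bin_gain l u = 0"
proof -
  have "value_iter l k u = 0" for k
    using assms by (cases k) auto
  then show ?thesis by (simp add: bin_gain_def)
qed

lemma bin_gain_lipschitz: "\<bar>bin_gain l u - bin_gain l' u\<bar> \<le> \<bar>l - l'\<bar> * escape_bound u"
  by (rule LIMSEQ_le_const2[OF tendsto_rabs[OF tendsto_diff[OF value_iter_tendsto value_iter_tendsto]]])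
    (auto simp: value_iter_lipschitz)

lemma bin_gain_fixed_point:
  assumes "u \<le> 1"
  shows "bin_gain l u = max 0 (l - C * overflow_prob u) + E (\<lambda>x. bin_gain l (u + x))"
proof (rule LIMSEQ_unique)
  show "(\<lambda>k. value_iter l (Suc k) u) \<longlonglongrightarrow> bin_gain l u"
    by (rule LIMSEQ_Suc) (rule value_iter_tendsto)
  have "(\<lambda>k. \<Sum>x\<in>set_pmf D. pmf D x * value_iter l k (u + x))
      \<longlonglongrightarrow> (\<Sum>x\<in>set_pmf D. pmf D x * bin_gain l (u + x))"
    by (intro tendsto_intros value_iter_tendsto)
  then have "(\<lambda>k. E (\<lambda>x. value_iter l k (u + x))) \<longlonglongrightarrow> E (\<lambda>x. bin_gain l (u + x))"
    by (simp add: integral_measure_pmf[OF finite_support])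
  then show "(\<lambda>k. value_iter l (Suc k) u)
      \<longlonglongrightarrow> max 0 (l - C * overflow_prob u) + E (\<lambda>x. bin_gain l (u + x))"
    using assms by (auto intro!: tendsto_intros)
qed

text \<open>
  The gain of a new bin is continuous in the reward: it is \<open>0\<close> for \<open>l = 0\<close>, and for \<open>l = 1 + C\<close>
  the first item alone already gains \<open>1\<close>.
\<close>

lemma break_even_reward: "\<exists>l\<ge>0. bin_gain l 0 = 1"
proof -
  have "continuous_on {0..1 + C} (\<lambda>l. bin_gain l 0)"
    by (rule lipschitz_on_continuous_on[where L = "escape_bound 0"])
      (auto simp: lipschitz_on_def dist_real_def escape_bound_nonneg mult.commute
        intro: order_trans[OF bin_gain_lipschitz])
  moreover have "bin_gain 0 0 \<le> 1"
    by (simp add: bin_gain_eq_0 C_nonneg overflow_prob_nonneg)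
  moreover have "1 \<le> bin_gain (1 + C) 0"
  proof -
    have "overflow_prob 0 \<le> E (\<lambda>x. 1)"
      unfolding overflow_prob_def by (rule E_mono) auto
    then have "C * overflow_prob 0 \<le> C"
      using C_nonneg by (simp add: mult_left_le)
    moreover have "0 \<le> E (\<lambda>x. bin_gain (1 + C) (0 + x))"
      by (rule E_nonneg) (rule bin_gain_nonneg)
    ultimately show ?thesis
      using bin_gain_fixed_point[of 0 "1 + C"] by (auto simp: max_def)
  qed
  ultimately show ?thesis
    using C_nonneg IVT'[of "\<lambda>l. bin_gain l 0" 0 1 "1 + C"] by auto
qed

end

text \<open>
  Only finitely many remaining capacities matter: lowering the capacity \<open>1 - u\<close> to the next
  item size (or \<open>0\<close>) does not change which items overflow. So the supremum of the usages with
  affordable overflow risk is attained.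
\<close>

lemma greatest_safe_usage:
  assumes "C * overflow_prob 0 \<le> l"
  shows "\<exists>\<alpha>\<in>{0..1}. C * overflow_prob \<alpha> \<le> l \<and>
    (\<forall>u\<in>{\<alpha><..1}. l < C * overflow_prob u)"
proof -
  \<comment> \<open>The candidates are remaining capacities; \<open>1\<close> is that of an empty bin.\<close>
  define Y where "Y = {y \<in> {0, 1} \<union> (set_pmf D \<inter> {0..1}). C * overflow_prob (1 - y) \<le> l}"
  have "finite Y" "1 \<in> Y"
    using assms finite_support by (auto simp: Y_def)
  define y where "y = Min Y"
  have "y \<in> Y"
    unfolding y_def using \<open>finite Y\<close> \<open>1 \<in> Y\<close> by (intro Min_in) auto
  have y_le: "y \<le> z" if "z \<in> Y" for z
    unfolding y_def using \<open>finite Y\<close> that by (rule Min_le)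
  have "l < C * overflow_prob u" if u: "u \<in> {1 - y<..1}" for u
  proof (rule ccontr)
    assume safe: "\<not> l < C * overflow_prob u"
    define Z where "Z = {z \<in> insert 0 (set_pmf D \<inter> {0..1}). z \<le> 1 - u}"
    define z where "z = Max Z"
    have "finite Z" "0 \<in> Z"
      using u finite_support by (auto simp: Z_def)
    then have "z \<in> Z"
      unfolding z_def by (intro Max_in) auto
    have le_z: "w \<le> z" if "w \<in> Z" for w
      unfolding z_def using \<open>finite Z\<close> that by (rule Max_ge)
    have "1 - z + x > 1 \<longleftrightarrow> u + x > 1" if "x \<in> set_pmf D" for x
    proof
      assume *: "1 - z + x > 1"
      have "0 \<le> x" using that support_nonneg by auto
      show "u + x > 1"
      proof (rule ccontr)
        assume "\<not> u + x > 1"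
        moreover have "0 \<le> u" using u \<open>y \<in> Y\<close> by (auto simp: Y_def)
        ultimately have "x \<in> Z" using that \<open>0 \<le> x\<close> by (auto simp: Z_def)
        then show False using le_z * by fastforce
      qed
    next
      assume "u + x > 1"
      then show "1 - z + x > 1" using \<open>z \<in> Z\<close> by (auto simp: Z_def)
    qed
    then have "overflow_prob (1 - z) = overflow_prob u"
      unfolding overflow_prob_def
      by (intro integral_cong_AE) (auto simp: AE_measure_pmf_iff)
    then have "z \<in> Y"
      using \<open>z \<in> Z\<close> safe by (auto simp: Y_def Z_def)
    then show False using y_le \<open>z \<in> Z\<close> u by (fastforce simp: Z_def)
  qed
  then show ?thesis
    using \<open>y \<in> Y\<close> by (intro bexI[of _ "1 - y"]) (auto simp: Y_def)
qed

text \<open>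
  At the break-even reward the gain of a new bin is positive. So packing into an empty bin cannot have
  a negative one-step gain, and the greatest safe usage exists.
\<close>

lemma bin_value_exists: "\<exists>l \<alpha> \<Phi>. bin_value l \<alpha> \<Phi>"
proof (cases "0 < E (\<lambda>x. min x 1)")
  case True
  then obtain l where l: "0 \<le> l" "bin_gain l 0 = 1"
    using break_even_reward by auto
  have "C * overflow_prob 0 \<le> l"
    using bin_gain_eq_0[OF True, of l 0] l by fastforce
  then obtain \<alpha> where \<alpha>: "\<alpha> \<in> {0..1}" "C * overflow_prob \<alpha> \<le> l"
    and above: "\<And>u. u \<in> {\<alpha><..1} \<Longrightarrow> l < C * overflow_prob u"
    using greatest_safe_usage by blast
  have "C * overflow_prob u \<le> l" if "u \<le> \<alpha>" for u
    using \<alpha>(2) mult_left_mono[OF overflow_prob_mono[OF that] C_nonneg] by linarith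
  then have below: "bin_gain l u = l - C * overflow_prob u + E (\<lambda>x. bin_gain l (u + x))"
    if "u \<le> \<alpha>" for u
    using that \<alpha>(1) bin_gain_fixed_point[OF True, of u l] by (simp add: max_absorb2)
  have "bin_gain l u = 0" if "u > \<alpha>" for u
    using that above[of u] bin_gain_beyond_1[OF True] bin_gain_eq_0[OF True, of l u]
    by (cases "u \<le> 1") auto
  moreover have "l - C * overflow_prob u + E (\<lambda>x. bin_gain l (u + x)) \<le> bin_gain l u"
    if "u \<le> 1" for u
    using bin_gain_fixed_point[OF True that] by simp
  moreover have "0 \<le> bin_gain l u \<and> bin_gain l u \<le> 1" if "0 \<le> u" for u
    using bin_gain_nonneg[OF True] bin_gain_antimono[OF True that, of l] l by simp
  ultimately have "bin_value l \<alpha> (bin_gain l)"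
    using l \<alpha>(1) below by (simp add: bin_value_def)
  then show ?thesis by blast
next
  \<comment> \<open>All items have size \<open>0\<close>. One bin takes any number of them, so a positive reward would earn an
    unbounded gain; with reward \<open>0\<close> the value \<open>1\<close> of the bin just never changes.\<close>
  case False
  have "0 \<le> E (\<lambda>x. min x 1)"
    using E_mono[of "\<lambda>_. 0" "\<lambda>x. min x 1"] support_nonneg by auto
  then have "E (\<lambda>x. min x 1) = 0" using False by simp
  then have "AE x in measure_pmf D. min x 1 = 0"
    by (subst (asm) integral_nonneg_eq_0_iff_AE)
      (use support_nonneg in \<open>auto simp: AE_measure_pmf_iff\<close>)
  then have zero: "\<And>x. x \<in> set_pmf D \<Longrightarrow> x = 0"
    by (fastforce simp: AE_measure_pmf_iff min_def split: if_splits)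
  have E_zero: "E f = f 0" for f
  proof -
    have "E f = E (\<lambda>_. f 0)"
      by (intro integral_cong_AE) (auto simp: AE_measure_pmf_iff dest: zero)
    then show ?thesis by simp
  qed
  have "bin_value 0 1 (\<lambda>u. of_bool (u \<le> 1))"
    by (auto simp: bin_value_def overflow_prob_def E_zero)
  then show ?thesis by blast
qed

section \<open>The potential of a packing\<close>

definition bin_potential :: "(real \<Rightarrow> real) \<Rightarrow> real \<Rightarrow> real" where
  "bin_potential \<Phi> u = 1 - \<Phi> u + C * of_bool (u > 1)"

text \<open>
  The sum ranges over all \<open>n\<close> available bins, opened or not, so that its index set does not depend
  on the history.
\<close>

definition packing_potential :: "(real \<Rightarrow> real) \<Rightarrow> nat \<Rightarrow> history \<Rightarrow> real" where
  "packing_potential \<Phi> n h = (\<Sum>b\<in>{1..n}. bin_potential \<Phi> (usage h b))"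

lemma E_bin_potential_snoc:
  "E (\<lambda>s. bin_potential \<Phi> (u + s)) = 1 - E (\<lambda>s. \<Phi> (u + s)) + C * overflow_prob u"
  by (simp add: bin_potential_def overflow_prob_def)

lemma E_packing_potential_snoc:
  assumes "c \<in> {1..n}"
  shows "E (\<lambda>s. packing_potential \<Phi> n (h @ [(c, s)])) =
    packing_potential \<Phi> n h +
      (E (\<lambda>s. bin_potential \<Phi> (usage h c + s)) - bin_potential \<Phi> (usage h c))"
  using assms by (simp add: packing_potential_def sum_usage_snoc)

text \<open>
  Unopened bins contribute nothing because \<open>bin_potential \<Phi> 0 = 0\<close>; an opened bin contributes its
  price and its overflow penalty, less the value that is still in it.
\<close>

lemma packing_cost_eq:
  assumes "\<Phi> 0 = 1" "opened h \<subseteq> {1..n}"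
  shows "real (card (opened h)) + C * real (card (overflowed h)) =
    packing_potential \<Phi> n h + (\<Sum>b\<in>opened h. \<Phi> (usage h b))"
proof -
  have fin: "finite (opened h)" by (simp add: opened_def)
  have "packing_potential \<Phi> n h = (\<Sum>b\<in>opened h. bin_potential \<Phi> (usage h b))"
    unfolding packing_potential_def using assms
    by (intro sum.mono_neutral_right) (auto simp: usage_unopened bin_potential_def)
  moreover have "(\<Sum>b\<in>opened h. of_bool (usage h b > 1)) = real (card (overflowed h))"
    using fin by (simp add: overflowed_def of_bool_def sum.If_cases Int_def)
  ultimately show ?thesis
    by (simp add: bin_potential_def sum.distrib sum_subtractf sum_distrib_left[symmetric])
qed

lemma cost_eq_expectation:
  "cost C n (\<lambda>_. D) P = measure_pmf.expectation (Pi_pmf {1..n} 0 (\<lambda>_. D))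
    (\<lambda>x. real (card (opened (run P x n))) + C * real (card (overflowed (run P x n))))"
  by (simp add: cost_def integrable_iid[OF finite_support] del: One_nat_def)

lemma expectation_items_mono:
  fixes f g :: "(nat \<Rightarrow> real) \<Rightarrow> real"
  assumes "\<And>x. (\<And>j. 0 \<le> x j) \<Longrightarrow> f x \<le> g x"
  shows "measure_pmf.expectation (Pi_pmf {1..n} 0 (\<lambda>_. D)) f \<le>
    measure_pmf.expectation (Pi_pmf {1..n} 0 (\<lambda>_. D)) g"
  using assms nonneg_iid[OF support_nonneg]
  by (intro integral_mono_AE integrable_iid finite_support)
    (auto simp: AE_measure_pmf_iff simp del: One_nat_def)

context
  fixes l \<alpha> :: real and \<Phi> :: "real \<Rightarrow> real"
  assumes bin_val: "bin_value l \<alpha> \<Phi>"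
begin

lemma new_bin_value: "\<Phi> 0 = 1"
  using bin_val by (simp add: bin_value_def)

lemma packing_potential_Nil: "packing_potential \<Phi> n [] = 0"
  by (simp add: packing_potential_def bin_potential_def new_bin_value)

text \<open>
  In terms of the potential the Bellman inequality says that an item costs at least \<open>l\<close>, whether it
  goes into a used bin or into a new one.
\<close>

lemma bin_potential_drift_ge:
  assumes "u \<in> {0..1}"
  shows "bin_potential \<Phi> u + l \<le> E (\<lambda>s. bin_potential \<Phi> (u + s))"
proof -
  have "l - C * overflow_prob u + E (\<lambda>x. \<Phi> (u + x)) \<le> \<Phi> u"
    using bin_val assms unfolding bin_value_def by blast
  then show ?thesis
    using assms unfolding E_bin_potential_snoc by (simp add: bin_potential_def)
qed

lemma bin_potential_drift_eq:
  assumes "u \<in> {0..\<alpha>}"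
  shows "E (\<lambda>s. bin_potential \<Phi> (u + s)) = bin_potential \<Phi> u + l"
proof -
  have "\<Phi> u = l - C * overflow_prob u + E (\<lambda>x. \<Phi> (u + x))"
    using bin_val assms unfolding bin_value_def by blast
  moreover have "u \<le> 1"
    using bin_val assms by (simp add: bin_value_def)
  ultimately show ?thesis
    unfolding E_bin_potential_snoc by (simp add: bin_potential_def)
qed

text \<open>
  A policy may keep several bins in use, but each item changes only one of them, so the one-bin
  bound applies in every round.
\<close>

theorem policy_cost_ge:
  assumes "is_policy n P"
  shows "l * real n \<le> cost C n (\<lambda>_. D) P"
proof -
  have "packing_potential \<Phi> n [] + l * real n \<le>
    measure_pmf.expectation (Pi_pmf {1..n} 0 (\<lambda>_. D)) (\<lambda>x. packing_potential \<Phi> n (run P x n))"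
  proof (rule expectation_run_drift[OF finite_support support_nonneg])
    fix x :: "nat \<Rightarrow> real" and i
    assume x: "\<And>j. 0 \<le> x j" and i: "i < n"
    define c where "c = P (run P x i)"
    have c: "c \<in> {1..n}" "c \<notin> overflowed (run P x i)"
      using assms x i unfolding is_policy_def c_def by auto
    then have "usage (run P x i) c \<le> 1"
      using usage_unopened[of c "run P x i"] by (fastforce simp: overflowed_def)
    then have "usage (run P x i) c \<in> {0..1}"
      using usage_run_nonneg[of x P i c] x by simp
    then have "l \<le> E (\<lambda>s. bin_potential \<Phi> (usage (run P x i) c + s)) -
        bin_potential \<Phi> (usage (run P x i) c)"
      using bin_potential_drift_ge by fastforce
    then show "packing_potential \<Phi> n (run P x i) + l \<le>
        E (\<lambda>s. packing_potential \<Phi> n (run P x i @ [(P (run P x i), s)]))"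
      using c by (simp only: c_def[symmetric] E_packing_potential_snoc)
  qed simp
  also have "\<dots> \<le> cost C n (\<lambda>_. D) P"
    unfolding cost_eq_expectation
  proof (rule expectation_items_mono)
    fix x :: "nat \<Rightarrow> real"
    assume x: "\<And>j. 0 \<le> x j"
    have "0 \<le> (\<Sum>b\<in>opened (run P x n). \<Phi> (usage (run P x n) b))"
      using bin_val usage_run_nonneg[of x P n] x by (intro sum_nonneg) (auto simp: bin_value_def)
    then show "packing_potential \<Phi> n (run P x n) \<le>
        real (card (opened (run P x n))) + C * real (card (overflowed (run P x n)))"
      using packing_cost_eq[of \<Phi> "run P x n" n] opened_run_subset[of n P x n] assms x new_bin_value
      by simp
  qed
  finally show ?thesis by (simp add: packing_potential_Nil)
qed

text \<open>
  The threshold policy packs only at usages where the Bellman inequality is an equality, and it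
  leaves a bin only when nothing more can be gained from it. The additive \<open>1\<close> is the value that the
  last bin may still have.
\<close>

theorem threshold_cost_le: "cost C n (\<lambda>_. D) (threshold \<alpha>) \<le> l * real n + 1"
proof -
  let ?P = "threshold \<alpha>"
  have \<alpha>: "0 \<le> \<alpha>" "\<alpha> \<le> 1" using bin_val by (auto simp: bin_value_def)
  have policy: "is_policy n ?P" by (rule is_policy_threshold) fact
  have "- packing_potential \<Phi> n [] + (- l) * real n \<le>
    measure_pmf.expectation (Pi_pmf {1..n} 0 (\<lambda>_. D)) (\<lambda>x. - packing_potential \<Phi> n (run ?P x n))"
  proof (rule expectation_run_drift[OF finite_support support_nonneg])
    fix x :: "nat \<Rightarrow> real" and i
    assume x: "\<And>j. 0 \<le> x j" and i: "i < n"
    define c where "c = ?P (run ?P x i)"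
    have c: "c \<in> {1..n}"
      using policy x i unfolding is_policy_def c_def by auto
    have "usage (run ?P x i) c \<in> {0..\<alpha>}"
      using threshold_usage_le[OF \<alpha>(1)] usage_run_nonneg[of x ?P i c] x by (simp add: c_def)
    then have "E (\<lambda>s. bin_potential \<Phi> (usage (run ?P x i) c + s)) -
        bin_potential \<Phi> (usage (run ?P x i) c) = l"
      using bin_potential_drift_eq by simp
    then show "- packing_potential \<Phi> n (run ?P x i) + - l \<le>
        E (\<lambda>s. - packing_potential \<Phi> n (run ?P x i @ [(?P (run ?P x i), s)]))"
      using c by (simp only: c_def[symmetric] E_packing_potential_snoc integral_minus)
  qed simp
  moreover have "cost C n (\<lambda>_. D) ?P \<le>
    measure_pmf.expectation (Pi_pmf {1..n} 0 (\<lambda>_. D)) (\<lambda>x. packing_potential \<Phi> n (run ?P x n) + 1)"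
    unfolding cost_eq_expectation
  proof (rule expectation_items_mono)
    fix x :: "nat \<Rightarrow> real"
    assume x: "\<And>j. 0 \<le> x j"
    let ?h = "run ?P x n"
    have nonneg: "0 \<le> usage ?h b" for b
      using usage_run_nonneg x by blast
    \<comment> \<open>Only the current bin has any value left.\<close>
    have "(\<Sum>b\<in>opened ?h. \<Phi> (usage ?h b)) =
        (\<Sum>b\<in>opened ?h. if b = fst (last ?h) then \<Phi> (usage ?h b) else 0)"
      using bin_val threshold_closed_usage[of _ \<alpha> x n] by (intro sum.cong) (auto simp: bin_value_def)
    also have "\<dots> \<le> 1"
      using bin_val nonneg by (subst sum.delta) (auto simp: opened_def bin_value_def)
    finally show "real (card (opened ?h)) + C * real (card (overflowed ?h)) \<le>
        packing_potential \<Phi> n ?h + 1"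
      using packing_cost_eq[of \<Phi> "?h" n] opened_run_subset[of n ?P x n] policy x new_bin_value
      by simp
  qed
  ultimately show ?thesis
    by (simp add: packing_potential_Nil integrable_iid[OF finite_support] del: One_nat_def)
qed

end

end

theorem corollary1p3:
  fixes C :: real and D :: "real pmf"
  assumes "C \<ge> 1"
    and "finite (set_pmf D)"
    and "set_pmf D \<subseteq> {0..}"
  shows "\<exists>\<alpha>\<in>{0..1}. \<forall>n\<ge>1.
    cost C n (\<lambda>_. D) (threshold \<alpha>) \<le> (3 + 2 * sqrt 2) * opt C n (\<lambda>_. D) + 1"
proof -
  interpret finite_item_law C D
    using assms by unfold_locales auto
  obtain l \<alpha> \<Phi> where bin_val: "bin_value l \<alpha> \<Phi>"
    using bin_value_exists by blast
  then have "0 \<le> l" "\<alpha> \<in> {0..1}" by (auto simp: bin_value_def)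
  have "cost C n (\<lambda>_. D) (threshold \<alpha>) \<le> (3 + 2 * sqrt 2) * opt C n (\<lambda>_. D) + 1" for n
  proof -
    have "is_policy n (threshold \<alpha>)"
      using \<open>\<alpha> \<in> {0..1}\<close> by (intro is_policy_threshold) auto
    then have opt: "l * real n \<le> opt C n (\<lambda>_. D)"
      unfolding opt_def using policy_cost_ge[OF bin_val] by (intro cINF_greatest) auto
    then have "0 \<le> opt C n (\<lambda>_. D)"
      using \<open>0 \<le> l\<close> by (meson mult_nonneg_nonneg of_nat_0_le_iff order_trans)
    \<comment> \<open>The potential argument gives the factor \<open>1\<close>, and \<open>opt\<close> is nonnegative.\<close>
    then have "1 * opt C n (\<lambda>_. D) \<le> (3 + 2 * sqrt 2) * opt C n (\<lambda>_. D)"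
      by (intro mult_right_mono) auto
    then show ?thesis
      using threshold_cost_le[OF bin_val, of n] opt by linarith
  qed
  then show ?thesis using \<open>\<alpha> \<in> {0..1}\<close> by blast
qed

end
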